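(* Consider a cake-cutting instance with $n$ agents (not necessarily hungry) and entitlements $\mathbf{w}=(w_1,\dots,w_n)$. Then a connected strongly-proportional allocation exists if and only if there exists a permutation $\sigma:[n]\to[n]$ such that $\textsc{Mark}_\sigma(0,\mathbf{w})<1$.
   Context: The cake is $C=[0,1]$, to be divided among agents $[n]$. Each agent $i$ has a valuation function $V_i$ on the algebra generated by intervals of $C$ that is non-negative, finitely additive, normalized ($V_i(C)=1$), with $x\mapsto V_i([0,x])$ continuous. Entitlements are $w_i>0$ with $\sum_i w_i=1$. An allocation is a partition $C=X_1\sqcup\cdots\sqcup X_n$ into finite unions of closed intervals, pairwise disjoint except possibly at endpoints; it is connected if each $X_i$ is a single interval and strongly-proportional if $V_i(X_i)>w_i$ for all $i$. For agent $i$, $x\in C$ and $r\in[0,1]$, $\textsc{Mark}_i(x,r)$ denotes the largest $z\in C$ with $V_i([x,z])=r$, or $\infty$ if $V_i([x,1])<r$. For a permutation $\sigma$, $x\in C$ and $\mathbf{r}=(r_1,\dots,r_n)$, define $x_0=x$ and $x_k=\textsc{Mark}_{\sigma(k)}(x_{k-1},r_{\sigma(k)})$ for $k=1,\dots,n$; if some $x_k=\infty$ then $\textsc{Mark}_\sigma(x,\mathbf{r})=\infty$, otherwise $\textsc{Mark}_\sigma(x,\mathbf{r})=x_n$.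
   Formalization: The formal version also assumes V_i({0}) = 0 (no atom at the left end of the cake), which continuity of V_i([0,x]) on [0,1] does not give; otherwise Mark_i(0,r) can be undefined and the claim fails (n=2, w=(1/2,1/2), half of the value at 0, half uniform). *)

theory Defs
  imports "HOL-Analysis.Analysis" "HOL-Combinatorics.Permutations"
begin

abbreviation cake :: "real set" where
  "cake \<equiv> {0..1}"

definition cake_algebra :: "real set set" where
  "cake_algebra = algebra cake hull {I. I \<subseteq> cake \<and> is_interval I}"

text \<open>Continuity of \<open>x \<mapsto> v [0,x]\<close> on the cake excludes atoms at every point except \<open>0\<close>.
  The clause \<^term>\<open>v {0} = 0\<close> excludes the remaining one: it is continuity of \<open>x \<mapsto> v [0,x]\<close>
  at \<open>0\<close> from the left, where \<open>[0,x]\<close> is empty.  It is what makes the mark below well defined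
  for \<open>x = 0\<close> and all \<open>r \<in> [0,1]\<close>, and what makes shared endpoints of pieces irrelevant.\<close>

definition valuation :: "(real set \<Rightarrow> real) \<Rightarrow> bool" where
  "valuation v \<longleftrightarrow>
     (\<forall>A\<in>cake_algebra. 0 \<le> v A) \<and>
     additive cake_algebra v \<and>
     v cake = 1 \<and>
     continuous_on cake (\<lambda>x. v {0..x}) \<and>
     v {0} = 0"

definition cake_instance :: "nat \<Rightarrow> (nat \<Rightarrow> real set \<Rightarrow> real) \<Rightarrow> (nat \<Rightarrow> real) \<Rightarrow> bool" where
  "cake_instance n V w \<longleftrightarrow>
     (\<forall>i\<in>{1..n}. valuation (V i)) \<and> (\<forall>i\<in>{1..n}. 0 < w i) \<and> (\<Sum>i=1..n. w i) = 1"

definition finite_union_of_intervals :: "real set \<Rightarrow> bool" where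
  "finite_union_of_intervals S \<longleftrightarrow>
     (\<exists>F. finite F \<and> (\<forall>I\<in>F. \<exists>a b. a \<le> b \<and> I = {a..b}) \<and> S = \<Union>F)"

text \<open>The endpoints of a finite union of closed intervals are its frontier points in \<open>\<real>\<close>.\<close>

definition allocation :: "nat \<Rightarrow> (nat \<Rightarrow> real set) \<Rightarrow> bool" where
  "allocation n X \<longleftrightarrow>
     (\<forall>i\<in>{1..n}. finite_union_of_intervals (X i)) \<and>
     (\<Union>i\<in>{1..n}. X i) = cake \<and>
     (\<forall>i\<in>{1..n}. \<forall>j\<in>{1..n}. i \<noteq> j \<longrightarrow> X i \<inter> X j \<subseteq> frontier (X i) \<inter> frontier (X j))"

definition connected_allocation :: "nat \<Rightarrow> (nat \<Rightarrow> real set) \<Rightarrow> bool" where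
  "connected_allocation n X \<longleftrightarrow>
     allocation n X \<and> (\<forall>i\<in>{1..n}. \<exists>a b. a \<le> b \<and> X i = {a..b})"

definition strongly_proportional ::
  "nat \<Rightarrow> (nat \<Rightarrow> real set \<Rightarrow> real) \<Rightarrow> (nat \<Rightarrow> real) \<Rightarrow> (nat \<Rightarrow> real set) \<Rightarrow> bool" where
  "strongly_proportional n V w X \<longleftrightarrow> (\<forall>i\<in>{1..n}. w i < V i (X i))"

definition mark :: "(real set \<Rightarrow> real) \<Rightarrow> real \<Rightarrow> real \<Rightarrow> ereal" where
  "mark v x r =
     (if v {x..1} < r then \<infinity> else ereal (GREATEST z. z \<in> cake \<and> v {x..z} = r))"

text \<open>The points \<open>x\<^sub>0, x\<^sub>1, \<dots>\<close>; once some point is \<open>\<infinity>\<close>, so are all later ones.\<close>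

fun mark_point ::
  "(nat \<Rightarrow> real set \<Rightarrow> real) \<Rightarrow> (nat \<Rightarrow> nat) \<Rightarrow> real \<Rightarrow> (nat \<Rightarrow> real) \<Rightarrow> nat \<Rightarrow> ereal" where
  "mark_point V \<sigma> x r 0 = ereal x"
| "mark_point V \<sigma> x r (Suc k) =
     (if mark_point V \<sigma> x r k = \<infinity> then \<infinity>
      else mark (V (\<sigma> (Suc k))) (real_of_ereal (mark_point V \<sigma> x r k)) (r (\<sigma> (Suc k))))"

definition mark_perm ::
  "nat \<Rightarrow> (nat \<Rightarrow> real set \<Rightarrow> real) \<Rightarrow> (nat \<Rightarrow> nat) \<Rightarrow> real \<Rightarrow> (nat \<Rightarrow> real) \<Rightarrow> ereal" where
  "mark_perm n V \<sigma> x r = mark_point V \<sigma> x r n"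

end

theory Submission imports Defs begin

text \<open>Given a connected strongly-proportional allocation, order the agents by the left endpoints
  of their pieces: inductively, the marks never overtake the right endpoints of the pieces, and the
  last mark stays strictly to the left of the last one. Conversely, because a mark is the
  \<^emph>\<open>largest\<close> point realising the value \<open>w\<^sub>i\<close>, moving the last mark up to \<open>1\<close> makes the last piece
  worth strictly more than its entitlement; by continuity part of the surplus can be handed over
  to the preceding agent by moving the preceding mark slightly to the right, and so on down to the
  first agent.\<close>

section \<open>Values of intervals: null points, additivity at a shared endpoint, continuity in
  either endpoint\<close>

lemma interval_in_cake_algebra:
  assumes "I \<subseteq> cake" "is_interval I"
  shows "I \<in> cake_algebra"
  unfolding cake_algebra_def using assms by (auto intro: hull_inc)

context
  fixes v :: "real set \<Rightarrow> real"
  assumes v: "valuation v"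
begin

lemma valuation_interval_nonneg:
  assumes "I \<subseteq> cake" "is_interval I"
  shows "0 \<le> v I"
  using v interval_in_cake_algebra[OF assms] unfolding valuation_def by blast

lemma valuation_interval_Un:
  assumes "I \<union> J \<subseteq> cake" "is_interval I" "is_interval J" "is_interval (I \<union> J)" "I \<inter> J = {}"
  shows "v (I \<union> J) = v I + v J"
proof -
  have "I \<in> cake_algebra" "J \<in> cake_algebra"
    using assms by (auto intro: interval_in_cake_algebra)
  with v assms(5) show ?thesis unfolding valuation_def additive_def by blast
qed

text \<open>An atom at \<open>a > 0\<close> would make the cumulative function jump by at least
  \<open>v {a}\<close> at \<open>a\<close>, against continuity. The point \<open>0\<close> is
  covered by a clause of \<open>valuation\<close>.\<close>

lemma valuation_singleton:
  assumes a: "a \<in> cake"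
  shows "v {a} = 0"
proof (rule ccontr)
  assume neq: "v {a} \<noteq> 0"
  have "v {0} = 0" using v unfolding valuation_def by blast
  with neq a have "a > 0" by (cases "a = 0") auto
  have "v {a} \<ge> 0" using a by (intro valuation_interval_nonneg) (auto simp: is_interval_1)
  with neq have pos: "v {a} > 0" by simp
  have "continuous_on cake (\<lambda>x. v {0..x})" using v unfolding valuation_def by blast
  with a pos obtain d where d: "d > 0"
    "\<And>y. y \<in> cake \<Longrightarrow> dist y a < d \<Longrightarrow> dist (v {0..y}) (v {0..a}) < v {a}"
    unfolding continuous_on_iff by blast
  \<comment> \<open>A point of the cake strictly left of \<open>a\<close> and within
    \<open>d\<close> of it. The interval from \<open>y\<close> to \<open>a\<close>, open at
    \<open>y\<close>, is worth at least \<open>v {a}\<close>, while continuity bounds its value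
    strictly below that.\<close>
  define y where "y = max 0 (a - d/2)"
  have y: "0 \<le> y" "y < a" "dist y a < d"
    using d(1) \<open>a > 0\<close> by (auto simp: y_def dist_real_def)
  have "v ({0..y} \<union> {y<..a}) = v {0..y} + v {y<..a}"
    using y a by (intro valuation_interval_Un) (auto simp: ivl_disj_un is_interval_1)
  moreover have "{0..y} \<union> {y<..a} = {0..a}" using y by auto
  moreover have "v ({y<..<a} \<union> {a}) = v {y<..<a} + v {a}"
    using y a by (intro valuation_interval_Un) (auto simp: is_interval_1)
  moreover have "{y<..<a} \<union> {a} = {y<..a}" using y by auto
  moreover have "v {y<..<a} \<ge> 0"
    using y a by (intro valuation_interval_nonneg) (auto simp: is_interval_1)
  moreover have "dist (v {0..y}) (v {0..a}) < v {a}" using d(2) y a by auto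
  ultimately show False by (simp add: dist_real_def)
qed

text \<open>Additivity needs disjoint sets, so \<open>b\<close> first goes to the right part only;
  being null, it can be added to the left part as well.\<close>

lemma valuation_split:
  assumes "0 \<le> a" "a \<le> b" "b \<le> c" "c \<le> 1"
  shows "v {a..c} = v {a..b} + v {b..c}"
proof -
  have "v ({a..<b} \<union> {b..c}) = v {a..<b} + v {b..c}"
    using assms by (intro valuation_interval_Un) (auto simp: is_interval_1)
  moreover have "{a..<b} \<union> {b..c} = {a..c}" using assms by auto
  moreover have "v ({a..<b} \<union> {b}) = v {a..<b} + v {b}"
    using assms by (intro valuation_interval_Un) (auto simp: is_interval_1)
  moreover have "{a..<b} \<union> {b} = {a..b}" using assms by auto
  moreover have "v {b} = 0" using assms by (intro valuation_singleton) auto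
  ultimately show ?thesis by simp
qed

lemma valuation_mono:
  assumes "0 \<le> a'" "a' \<le> a" "a \<le> b" "b \<le> b'" "b' \<le> 1"
  shows "v {a..b} \<le> v {a'..b'}"
proof -
  have "v {a'..b'} = v {a'..a} + v {a..b'}" "v {a..b'} = v {a..b} + v {b..b'}"
    using assms by (intro valuation_split; simp)+
  moreover have "v {a'..a} \<ge> 0" "v {b..b'} \<ge> 0"
    using assms by (intro valuation_interval_nonneg; auto)+
  ultimately show ?thesis by simp
qed

lemma continuous_on_valuation_right:
  assumes "0 \<le> x"
  shows "continuous_on {x..1} (\<lambda>z. v {x..z})"
proof -
  have "continuous_on cake (\<lambda>z. v {0..z})" using v unfolding valuation_def by blast
  then have "continuous_on {x..1} (\<lambda>z. v {0..z})"
    by (rule continuous_on_subset) (use assms in auto)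
  then have "continuous_on {x..1} (\<lambda>z. v {0..z} - v {0..x})"
    by (intro continuous_on_diff continuous_on_const)
  moreover have "v {0..z} - v {0..x} = v {x..z}" if "z \<in> {x..1}" for z
    using valuation_split[of 0 x z] assms that by auto
  ultimately show ?thesis by (rule continuous_on_eq)
qed

lemma continuous_on_valuation_left:
  assumes "c \<le> 1"
  shows "continuous_on {0..c} (\<lambda>x. v {x..c})"
proof -
  have "continuous_on cake (\<lambda>z. v {0..z})" using v unfolding valuation_def by blast
  then have "continuous_on {0..c} (\<lambda>z. v {0..z})"
    by (rule continuous_on_subset) (use assms in auto)
  then have "continuous_on {0..c} (\<lambda>z. v {0..c} - v {0..z})"
    by (intro continuous_on_diff continuous_on_const)
  moreover have "v {0..c} - v {0..z} = v {z..c}" if "z \<in> {0..c}" for z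
    using valuation_split[of 0 z c] assms that by auto
  ultimately show ?thesis by (rule continuous_on_eq)
qed

section \<open>Marks as largest points of level sets\<close>

text \<open>The intermediate value theorem makes the level set \<open>S\<close> nonempty and
  continuity makes it compact, so it has a maximum, which is the mark. Beyond a maximal solution the
  value is no longer \<open>r\<close>, and by monotonicity it is then larger.\<close>

lemma mark_finite:
  assumes x: "x \<in> cake" and r: "0 < r" "r \<le> v {x..1}"
  obtains z where "mark v x r = ereal z" "x < z" "z \<le> 1" "v {x..z} = r"
    "\<And>y. z < y \<Longrightarrow> y \<le> 1 \<Longrightarrow> r < v {x..y}"
proof -
  define S where "S = {z \<in> {x..1}. v {x..z} = r}"
  have cont: "continuous_on {x..1} (\<lambda>z. v {x..z})"
    using continuous_on_valuation_right x by simp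
  have vx: "v {x..x} = 0" using valuation_singleton x by simp
  have "\<exists>z\<ge>x. z \<le> 1 \<and> v {x..z} = r"
    using x r vx by (intro IVT' cont) auto
  then have "S \<noteq> {}" by (auto simp: S_def)
  moreover have "compact S"
  proof -
    have "closed S"
      unfolding S_def using continuous_closed_preimage_constant[OF cont, of r] by simp
    moreover have "bounded S" by (rule bounded_subset[of "{x..1}"]) (auto simp: S_def)
    ultimately show ?thesis by (simp add: compact_eq_bounded_closed)
  qed
  ultimately obtain z where z: "z \<in> S" "\<And>t. t \<in> S \<Longrightarrow> t \<le> z"
    using compact_attains_sup[of S] by metis
  from z(1) have z1: "x \<le> z" "z \<le> 1" "v {x..z} = r" by (auto simp: S_def)
  with vx r have "x < z" by (cases "x = z") auto
  moreover have "(GREATEST z. z \<in> cake \<and> v {x..z} = r) = z"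
  proof (rule Greatest_equality)
    show "z \<in> cake \<and> v {x..z} = r" using z1 x by auto
    fix t assume t: "t \<in> cake \<and> v {x..t} = r"
    \<comment> \<open>\<open>mark\<close> searches the whole cake, so solutions
      \<open>t < x\<close>, where the interval is empty, must be compared too; they lie left of
      \<open>z\<close> in any case.\<close>
    show "t \<le> z"
    proof (cases "t < x")
      case False
      then show ?thesis using t z(2) by (auto simp: S_def)
    qed (use z1 in simp)
  qed
  then have "mark v x r = ereal z" using r by (simp add: mark_def)
  moreover have "r < v {x..y}" if "z < y" "y \<le> 1" for y
  proof -
    have "v {x..z} \<le> v {x..y}" using that z1 x by (intro valuation_mono) auto
    moreover have "v {x..y} \<noteq> r" using z(2)[of y] that z1 by (auto simp: S_def)
    ultimately show ?thesis using z1 by simp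
  qed
  ultimately show thesis using that z1 by blast
qed

text \<open>This is how surplus is handed over: by continuity in the left endpoint, a strict
  inequality survives a small move of that endpoint to the right.\<close>

lemma valuation_left_slack:
  assumes "0 \<le> x" "x < c" "c \<le> 1" "r < v {x..c}"
  obtains d where "x < d" "d < c" "r < v {d..c}"
proof -
  have "continuous_on {0..c} (\<lambda>x. v {x..c})" using assms continuous_on_valuation_left by simp
  moreover have "x \<in> {0..c}" "v {x..c} - r > 0" using assms by auto
  ultimately obtain e where e: "e > 0"
    "\<And>y. y \<in> {0..c} \<Longrightarrow> dist y x < e \<Longrightarrow> dist (v {y..c}) (v {x..c}) < v {x..c} - r"
    unfolding continuous_on_iff by blast
  \<comment> \<open>Half of \<open>e\<close> keeps \<open>d\<close> within the continuity radius,
    half of the gap keeps it left of \<open>c\<close>.\<close>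
  define d where "d = x + min (e/2) ((c - x)/2)"
  have d: "x < d" "d < c" "dist d x < e"
    using e(1) assms by (auto simp: d_def dist_real_def min_def field_simps)
  then have "dist (v {d..c}) (v {x..c}) < v {x..c} - r" using e(2) assms by auto
  then have "r < v {d..c}" unfolding dist_real_def by linarith
  with d that show thesis by blast
qed

end

section \<open>Ordering intervals on the line\<close>

lemma ex_sorting_permutation:
  fixes f :: "nat \<Rightarrow> 'a::linorder"
  obtains \<sigma> where "\<sigma> permutes {1..n}"
    "\<And>i j. 1 \<le> i \<Longrightarrow> i < j \<Longrightarrow> j \<le> n \<Longrightarrow> f (\<sigma> i) \<le> f (\<sigma> j)"
proof -
  define xs where "xs = sort_key f [1..<Suc n]"
  have xs: "distinct xs" "set xs = {1..n}" "length xs = n" "sorted (map f xs)"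
    by (auto simp: xs_def simp del: upt_Suc)
  \<comment> \<open>Positions count from 1 and list indices from 0; outside \<open>{1..n}\<close>
    the identity is required by \<open>permutes\<close>.\<close>
  define \<sigma> where "\<sigma> = (\<lambda>k. if k \<in> {1..n} then xs ! (k - 1) else k)"
  have "bij_betw (\<lambda>k. k - 1) {1..n} {..<n}"
    by (rule bij_betw_byWitness[where f' = Suc]) auto
  moreover have "bij_betw (\<lambda>k. xs ! k) {..<n} {1..n}"
    using bij_betw_nth xs by metis
  ultimately have "bij_betw ((\<lambda>k. xs ! k) \<circ> (\<lambda>k. k - 1)) {1..n} {1..n}"
    by (rule bij_betw_trans)
  then have "bij_betw \<sigma> {1..n} {1..n}"
    by (rule bij_betw_cong[THEN iffD1, rotated]) (auto simp: \<sigma>_def)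
  then have "\<sigma> permutes {1..n}" by (rule bij_imp_permutes) (auto simp: \<sigma>_def)
  moreover have "f (\<sigma> i) \<le> f (\<sigma> j)" if "1 \<le> i" "i < j" "j \<le> n" for i j
    using sorted_nth_mono[OF xs(4), of "i - 1" "j - 1"] that xs(3) by (auto simp: \<sigma>_def)
  ultimately show thesis by (rule that)
qed

lemma closed_intervals_meeting_in_frontiers:
  fixes a b c d :: real
  assumes "a < b" "c < d" "{a..b} \<inter> {c..d} \<subseteq> frontier {a..b} \<inter> frontier {c..d}" "a \<le> c"
  shows "b \<le> c"
proof (rule ccontr)
  assume "\<not> b \<le> c"
  \<comment> \<open>If the intervals overlapped properly, this midpoint of the overlap would be
    interior to both, hence in neither frontier.\<close>
  define t where "t = (c + min b d) / 2"
  have "a < t" "t < b" "c < t" "t < d"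
    using assms \<open>\<not> b \<le> c\<close> by (auto simp: t_def min_def field_simps)
  moreover have "frontier {a..b} = {a, b}"
    using assms by (auto simp: frontier_def)
  ultimately show False using assms(3) by (auto dest!: subsetD[of _ _ t])
qed

lemma Union_consecutive_intervals:
  fixes y :: "nat \<Rightarrow> real"
  assumes "\<And>j. j \<in> {1..Suc k} \<Longrightarrow> y (j - 1) \<le> y j"
  shows "y 0 \<le> y (Suc k) \<and> (\<Union>j\<in>{1..Suc k}. {y (j - 1)..y j}) = {y 0..y (Suc k)}"
  using assms
proof (induction k)
  case 0
  then show ?case using "0"[of 1] by simp
next
  case (Suc k)
  then have IH: "y 0 \<le> y (Suc k)" "(\<Union>j\<in>{1..Suc k}. {y (j - 1)..y j}) = {y 0..y (Suc k)}"
    by auto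
  have "y (Suc k) \<le> y (Suc (Suc k))" using Suc.prems[of "Suc (Suc k)"] by simp
  moreover have "{1..Suc (Suc k)} = insert (Suc (Suc k)) {1..Suc k}" by auto
  then have "(\<Union>j\<in>{1..Suc (Suc k)}. {y (j - 1)..y j})
      = {y (Suc k)..y (Suc (Suc k))} \<union> {y 0..y (Suc k)}" using IH by simp
  ultimately show ?case using IH by auto
qed

section \<open>From an allocation to a permutation\<close>

lemma mark_perm_less_one_if_allocation:
  assumes inst: "cake_instance n V w"
    and X: "connected_allocation n X" "strongly_proportional n V w X"
  shows "\<exists>\<sigma>. \<sigma> permutes {1..n} \<and> mark_perm n V \<sigma> 0 w < 1"
proof -
  have V: "\<And>i. i \<in> {1..n} \<Longrightarrow> valuation (V i)" and w: "\<And>i. i \<in> {1..n} \<Longrightarrow> 0 < w i"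
    and sum: "(\<Sum>i=1..n. w i) = 1"
    using inst by (auto simp: cake_instance_def)
  have "n \<noteq> 0" using sum by (cases n) auto
  from X(1) have "\<exists>a b. \<forall>i\<in>{1..n}. a i \<le> b i \<and> X i = {a i..b i}"
    unfolding connected_allocation_def by metis
  then obtain a b where ab: "\<And>i. i \<in> {1..n} \<Longrightarrow> a i \<le> b i \<and> X i = {a i..b i}"
    by blast
  have worth: "w i < V i {a i..b i}" if "i \<in> {1..n}" for i
    using X(2) ab that unfolding strongly_proportional_def by metis
  have "(\<Union>i\<in>{1..n}. X i) = cake"
    using X(1) unfolding connected_allocation_def allocation_def by simp
  then have "{a i..b i} \<subseteq> cake" if "i \<in> {1..n}" for i
    using ab[OF that] that by (metis UN_upper)
  then have ab01: "0 \<le> a i" "b i \<le> 1" if "i \<in> {1..n}" for i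
    using ab[OF that] that by fastforce+
  \<comment> \<open>A one-point piece is worth \<open>0\<close>, which cannot exceed a positive
    entitlement.\<close>
  have less: "a i < b i" if i: "i \<in> {1..n}" for i
  proof (rule ccontr)
    assume "\<not> a i < b i"
    then have eq: "b i = a i" and "a i \<in> cake" using ab[OF i] ab01[OF i] by simp_all
    then have "V i {a i..b i} = 0" using valuation_singleton[OF V[OF i]] by (simp only: eq) simp
    then show False using worth[OF i] w[OF i] by linarith
  qed
  obtain \<sigma> where \<sigma>: "\<sigma> permutes {1..n}"
    "\<And>i j. 1 \<le> i \<Longrightarrow> i < j \<Longrightarrow> j \<le> n \<Longrightarrow> a (\<sigma> i) \<le> a (\<sigma> j)"
    using ex_sorting_permutation[of n a] by metis
  have \<sigma>_in: "\<sigma> i \<in> {1..n}" if "1 \<le> i" "i \<le> n" for i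
    using that permutes_in_image[OF \<sigma>(1)] by auto
  have sep: "b (\<sigma> i) \<le> a (\<sigma> j)" if "1 \<le> i" "i < j" "j \<le> n" for i j
  proof (rule closed_intervals_meeting_in_frontiers)
    have in': "\<sigma> i \<in> {1..n}" "\<sigma> j \<in> {1..n}" using \<sigma>_in that by auto
    then show "a (\<sigma> i) < b (\<sigma> i)" "a (\<sigma> j) < b (\<sigma> j)" using less by auto
    show "a (\<sigma> i) \<le> a (\<sigma> j)" using \<sigma>(2) that by blast
    have "\<sigma> i \<noteq> \<sigma> j" using permutes_inj[OF \<sigma>(1)] that by (auto dest: injD)
    then show "{a (\<sigma> i)..b (\<sigma> i)} \<inter> {a (\<sigma> j)..b (\<sigma> j)}
      \<subseteq> frontier {a (\<sigma> i)..b (\<sigma> i)} \<inter> frontier {a (\<sigma> j)..b (\<sigma> j)}"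
      using X(1) in' ab unfolding connected_allocation_def allocation_def by metis
  qed
  \<comment> \<open>The bound by later left endpoints carries the induction; the strict bound by the
    current right endpoint gives the final inequality at \<open>k = n\<close>.\<close>
  have marks: "\<exists>x. mark_point V \<sigma> 0 w k = ereal x \<and> x \<in> cake \<and>
      (\<forall>j. k < j \<longrightarrow> j \<le> n \<longrightarrow> x \<le> a (\<sigma> j)) \<and> (0 < k \<longrightarrow> x < b (\<sigma> k))" if "k \<le> n" for k
    using that
  proof (induction k)
    case 0
    then show ?case using ab01 \<sigma>_in by auto
  next
    case (Suc k)
    then obtain x where x: "mark_point V \<sigma> 0 w k = ereal x" "x \<in> cake" "x \<le> a (\<sigma> (Suc k))"
      by auto
    define i where "i = \<sigma> (Suc k)"
    have i: "i \<in> {1..n}" using \<sigma>_in Suc.prems by (simp add: i_def)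
    \<comment> \<open>Agent \<open>i\<close> starts from \<open>x\<close>, at or before the piece,
      and so values the stretch up to \<open>b i\<close> above \<open>w i\<close>.\<close>
    have xb: "V i {a i..b i} \<le> V i {x..b i}"
      using x ab01[OF i] less[OF i] by (intro valuation_mono[OF V[OF i]]) (auto simp: i_def)
    have "V i {x..b i} \<le> V i {x..1}"
      using x ab01[OF i] less[OF i] by (intro valuation_mono[OF V[OF i]]) (auto simp: i_def)
    with xb worth[OF i] have "w i \<le> V i {x..1}" by simp
    then obtain z where z: "mark (V i) x (w i) = ereal z" "x < z" "z \<le> 1" "V i {x..z} = w i"
      using mark_finite[OF V[OF i] x(2) w[OF i]] by metis
    \<comment> \<open>Otherwise the stretch up to \<open>z\<close>, worth exactly
      \<open>w i\<close>, would contain the whole piece.\<close>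
    have "z < b i"
    proof (rule ccontr)
      assume "\<not> z < b i"
      then have "V i {x..b i} \<le> V i {x..z}"
        using x z less[OF i] by (intro valuation_mono[OF V[OF i]]) (auto simp: i_def)
      with xb worth[OF i] z show False by simp
    qed
    moreover have "z \<le> a (\<sigma> j)" if "Suc k < j" "j \<le> n" for j
      using sep[of "Suc k" j] that \<open>z < b i\<close> by (simp add: i_def)
    ultimately show ?case using z x by (auto simp: i_def)
  qed
  obtain x where x: "mark_point V \<sigma> 0 w n = ereal x" "x < b (\<sigma> n)"
    using marks[of n] \<open>n \<noteq> 0\<close> by auto
  moreover have "b (\<sigma> n) \<le> 1" using ab01 \<sigma>_in \<open>n \<noteq> 0\<close> by simp
  ultimately have "mark_perm n V \<sigma> 0 w < 1" by (simp add: mark_perm_def one_ereal_def)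
  with \<sigma>(1) show ?thesis by blast
qed

section \<open>From a permutation to an allocation\<close>

text \<open>The claim covers every target \<open>c\<close> beyond the mark, not just
  \<open>1\<close>, because the inductive step applies it to a cut \<open>d\<close> to the right of
  the previous mark. The first cut is only required to be nonnegative: for \<open>k = 0\<close> it
  must equal the target.\<close>

lemma mark_point_finite_cuts:
  assumes V: "\<And>j. j \<in> {1..k} \<Longrightarrow> valuation (V (\<sigma> j))"
    and w: "\<And>j. j \<in> {1..k} \<Longrightarrow> 0 < w (\<sigma> j)"
    and fin: "mark_point V \<sigma> 0 w k \<noteq> \<infinity>"
  shows "\<exists>x. mark_point V \<sigma> 0 w k = ereal x \<and> x \<in> cake \<and>
    (\<forall>c. x < c \<longrightarrow> c \<le> 1 \<longrightarrow>
      (\<exists>y. 0 \<le> y 0 \<and> y k = c \<and>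
        (\<forall>j\<in>{1..k}. y (j - 1) < y j \<and> w (\<sigma> j) < V (\<sigma> j) {y (j - 1)..y j})))"
  using assms
proof (induction k)
  case 0
  have "\<exists>y::nat \<Rightarrow> real. 0 \<le> y 0 \<and> y 0 = c" if "0 < c" for c
    using that by (intro exI[of _ "\<lambda>_. c"]) auto
  then show ?case by auto
next
  case (Suc k)
  have fin: "mark_point V \<sigma> 0 w k \<noteq> \<infinity>" using Suc.prems(3) by auto
  with Suc obtain x where x: "mark_point V \<sigma> 0 w k = ereal x" "x \<in> cake"
    and cuts: "\<And>c. x < c \<Longrightarrow> c \<le> 1 \<Longrightarrow> \<exists>y. 0 \<le> y 0 \<and> y k = c \<and>
        (\<forall>j\<in>{1..k}. y (j - 1) < y j \<and> w (\<sigma> j) < V (\<sigma> j) {y (j - 1)..y j})"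
    by auto
  define i where "i = \<sigma> (Suc k)"
  have Vi: "valuation (V i)" and wi: "0 < w i" using Suc.prems by (auto simp: i_def)
  have mark: "mark_point V \<sigma> 0 w (Suc k) = mark (V i) x (w i)" using x by (simp add: i_def)
  with Suc.prems(3) have "w i \<le> V i {x..1}" by (auto simp: mark_def split: if_splits)
  then obtain z where z: "mark (V i) x (w i) = ereal z" "x < z" "z \<le> 1"
    "\<And>c. z < c \<Longrightarrow> c \<le> 1 \<Longrightarrow> w i < V i {x..c}"
    using mark_finite[OF Vi x(2) wi] by metis
  have "\<exists>y. 0 \<le> y 0 \<and> y (Suc k) = c \<and>
      (\<forall>j\<in>{1..Suc k}. y (j - 1) < y j \<and> w (\<sigma> j) < V (\<sigma> j) {y (j - 1)..y j})"
    if c: "z < c" "c \<le> 1" for c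
  proof -
    \<comment> \<open>Since \<open>c\<close> lies beyond the mark \<open>z\<close>, agent
      \<open>i\<close> has a surplus on \<open>{x..c}\<close>; giving up the part before
      \<open>d\<close> leaves more than \<open>w i\<close> and room for the earlier agents.\<close>
    obtain d where d: "x < d" "d < c" "w i < V i {d..c}"
      using valuation_left_slack[OF Vi, of x c "w i"] z c x(2) by auto
    then obtain y where y: "0 \<le> y 0" "y k = d"
      "\<forall>j\<in>{1..k}. y (j - 1) < y j \<and> w (\<sigma> j) < V (\<sigma> j) {y (j - 1)..y j}"
      using cuts[of d] c by auto
    show ?thesis
      using y d by (intro exI[of _ "y(Suc k := c)"]) (auto simp: i_def le_Suc_eq)
  qed
  then show ?case using mark z x(2) by auto
qed

lemma allocation_if_mark_perm_less_one:
  assumes inst: "cake_instance n V w"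
    and \<sigma>: "\<sigma> permutes {1..n}" and less: "mark_perm n V \<sigma> 0 w < 1"
  shows "\<exists>X. connected_allocation n X \<and> strongly_proportional n V w X"
proof -
  have V: "\<And>i. i \<in> {1..n} \<Longrightarrow> valuation (V i)" and w: "\<And>i. i \<in> {1..n} \<Longrightarrow> 0 < w i"
    and sum: "(\<Sum>i=1..n. w i) = 1"
    using inst by (auto simp: cake_instance_def)
  have "n \<noteq> 0" using sum by (cases n) auto
  have \<sigma>_in: "\<sigma> j \<in> {1..n}" if "j \<in> {1..n}" for j
    using that permutes_in_image[OF \<sigma>] by auto
  have fin: "mark_point V \<sigma> 0 w n \<noteq> \<infinity>" using less by (auto simp: mark_perm_def)
  obtain x where x: "mark_point V \<sigma> 0 w n = ereal x"
    and cuts: "\<And>c. x < c \<Longrightarrow> c \<le> 1 \<Longrightarrow> \<exists>y. 0 \<le> y 0 \<and> y n = c \<and>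
        (\<forall>j\<in>{1..n}. y (j - 1) < y j \<and> w (\<sigma> j) < V (\<sigma> j) {y (j - 1)..y j})"
    using mark_point_finite_cuts[of n V \<sigma> w, OF V[OF \<sigma>_in] w[OF \<sigma>_in] fin] by auto
  have "x < 1" using less x by (simp add: mark_perm_def one_ereal_def)
  then obtain y' where y': "0 \<le> y' 0" "y' n = 1"
    "\<And>j. j \<in> {1..n} \<Longrightarrow> y' (j - 1) < y' j"
    "\<And>j. j \<in> {1..n} \<Longrightarrow> w (\<sigma> j) < V (\<sigma> j) {y' (j - 1)..y' j}"
    using cuts[of 1] by auto
  \<comment> \<open>The cuts may start to the right of \<open>0\<close>. Moving the first one to
    \<open>0\<close> covers the cake and only enlarges the first piece.\<close>
  define y where "y = y'(0 := 0)"
  have y0: "y 0 = 0" and yn: "y n = 1" using y' \<open>n \<noteq> 0\<close> by (auto simp: y_def)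
  have y'_le: "y' i \<le> y' j" if "i \<le> j" "j \<le> n" for i j
    using that
  proof (induction j)
    case (Suc j)
    then show ?case using y'(3)[of "Suc j"] by (cases "i = Suc j") auto
  qed simp
  have step: "y (j - 1) < y j" if "j \<in> {1..n}" for j
    using y'(1) y'(3)[OF that] that by (auto simp: y_def)
  have y_le: "y i \<le> y j" if "i \<le> j" "j \<le> n" for i j
    using y'_le[OF that] y'_le[of 0 j] y'(1) that by (auto simp: y_def)
  have worth: "w (\<sigma> j) < V (\<sigma> j) {y (j - 1)..y j}" if j: "j \<in> {1..n}" for j
  proof -
    have "V (\<sigma> j) {y' (j - 1)..y' j} \<le> V (\<sigma> j) {y (j - 1)..y j}"
    proof (rule valuation_mono[OF V[OF \<sigma>_in[OF j]]])
      show "0 \<le> y (j - 1)" using y_le[of 0 "j - 1"] j y0 by auto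
      show "y (j - 1) \<le> y' (j - 1)" "y' j \<le> y j" using y'(1) j by (auto simp: y_def)
      show "y' (j - 1) \<le> y' j" using y'(3)[OF j] by simp
      show "y j \<le> 1" using y_le[of j n] j yn by auto
    qed
    with y'(4)[OF j] show ?thesis by simp
  qed
  \<comment> \<open>The piece at position \<open>j\<close> belongs to agent
    \<open>\<sigma> j\<close>, so agent \<open>i\<close> receives the piece at position
    \<open>\<tau> i\<close>.\<close>
  define \<tau> where "\<tau> = inv \<sigma>"
  have \<tau>: "\<tau> permutes {1..n}" unfolding \<tau>_def by (rule permutes_inv[OF \<sigma>])
  have \<tau>_in: "\<tau> i \<in> {1..n}" if "i \<in> {1..n}" for i
    using that permutes_in_image[OF \<tau>] by auto
  have \<sigma>\<tau>: "\<sigma> (\<tau> i) = i" for i using permutes_inverses[OF \<sigma>] by (simp add: \<tau>_def)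
  define Y where "Y j = {y (j - 1)..y j}" for j
  have frontier_Y: "frontier (Y j) = {y (j - 1), y j}" if "j \<in> {1..n}" for j
    using step[OF that] by (auto simp: Y_def frontier_def)
  have meet: "Y i \<inter> Y j \<subseteq> frontier (Y i) \<inter> frontier (Y j)"
    if "i \<in> {1..n}" "j \<in> {1..n}" "i < j" for i j
  proof -
    \<comment> \<open>Pieces at positions \<open>i < j\<close> can share only a point that is both
      the right end of the first and the left end of the second.\<close>
    have "y i \<le> y (j - 1)" using that by (intro y_le) auto
    then have "Y i \<inter> Y j \<subseteq> {y i} \<inter> {y (j - 1)}" by (auto simp: Y_def)
    with frontier_Y that show ?thesis by blast
  qed
  \<comment> \<open>The union lemma counts \<open>Suc k\<close> intervals, hence the instance
    \<open>n - 1\<close>, with \<open>n\<close> nonzero because the entitlements sum to 1.\<close>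
  have "(\<Union>j\<in>{1..n}. Y j) = cake"
    using Union_consecutive_intervals[of "n - 1" y] step \<open>n \<noteq> 0\<close> y0 yn
    by (auto simp: Y_def less_imp_le)
  moreover have "(\<Union>i\<in>{1..n}. Y (\<tau> i)) = (\<Union>j\<in>{1..n}. Y j)"
    using permutes_image[OF \<tau>] by (metis image_image)
  moreover have "Y (\<tau> i) \<inter> Y (\<tau> j) \<subseteq> frontier (Y (\<tau> i)) \<inter> frontier (Y (\<tau> j))"
    if "i \<in> {1..n}" "j \<in> {1..n}" "i \<noteq> j" for i j
  proof -
    have "\<tau> i \<noteq> \<tau> j" using that(3) \<sigma>\<tau> by metis
    with meet[of "\<tau> i" "\<tau> j"] meet[of "\<tau> j" "\<tau> i"] \<tau>_in that show ?thesis
      by (metis inf_commute nat_neq_iff)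
  qed
  moreover have ivl: "\<exists>a b. a \<le> b \<and> Y (\<tau> i) = {a..b}" if "i \<in> {1..n}" for i
    using step[OF \<tau>_in[OF that]] unfolding Y_def by (metis less_imp_le)
  moreover have "finite_union_of_intervals (Y (\<tau> i))" if "i \<in> {1..n}" for i
    unfolding finite_union_of_intervals_def
    using ivl[OF that] by (intro exI[of _ "{Y (\<tau> i)}"]) auto
  ultimately have "connected_allocation n (\<lambda>i. Y (\<tau> i))"
    unfolding connected_allocation_def allocation_def by simp
  moreover have "strongly_proportional n V w (\<lambda>i. Y (\<tau> i))"
    unfolding strongly_proportional_def Y_def using worth[OF \<tau>_in] \<sigma>\<tau> by metis
  ultimately show ?thesis by blast
qed

theorem theorem7:
  fixes n :: nat and V :: "nat \<Rightarrow> real set \<Rightarrow> real" and w :: "nat \<Rightarrow> real"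
  assumes "cake_instance n V w"
  shows "(\<exists>X. connected_allocation n X \<and> strongly_proportional n V w X) \<longleftrightarrow>
         (\<exists>\<sigma>. \<sigma> permutes {1..n} \<and> mark_perm n V \<sigma> 0 w < 1)"
  using mark_perm_less_one_if_allocation[OF assms] allocation_if_mark_perm_less_one[OF assms]
  by blast

end
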